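(* Let $k,l$ be positive integers and let $M$ be a matroid with Tutte polynomial $T_M(x,y)=\sum_{i,j\ge 0}t_{i,j}x^iy^j$. Then $M$ is $(k,l)$-uniform if and only if $t_{i,j}=0$ for all pairs $(i,j)$ with $i\ge k$ and $j\ge l$.
   Context: For positive integers $k,l$, a matroid is called $(k,l)$-uniform if it has no minor isomorphic to $U_{k,k}\oplus U_{0,l}$ (the matroid consisting of $k$ coloops and $l$ loops). The Tutte polynomial of $M$ is $T_M(x,y)=\sum_B x^{\mathrm{int}(B)}y^{\mathrm{ext}(B)}$, the sum over all bases $B$ of $M$, where for a fixed total order on the ground set, $\mathrm{int}(B)$ is the number of $v\in B$ that are the smallest element of the unique cocircuit contained in $(E-B)\cup\{v\}$, and $\mathrm{ext}(B)$ is the number of $v\notin B$ that are the smallest element of the unique circuit contained in $B\cup\{v\}$; this polynomial is independent of the order. Thus $t_{i,j}$ is the number of bases with internal activity $i$ and external activity $j$. *)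

theory Defs
  imports Main "HOL-Computational_Algebra.Polynomial"
begin

datatype 'a indep_system = Indep_System (ground: "'a set") (indeps: "'a set set")

locale matroid =
  fixes M :: "'a indep_system"
  assumes finite_ground: "finite (ground M)"
    and indep_subset_ground: "X \<in> indeps M \<Longrightarrow> X \<subseteq> ground M"
    and indep_empty: "{} \<in> indeps M"
    and indep_subset: "X \<in> indeps M \<Longrightarrow> Y \<subseteq> X \<Longrightarrow> Y \<in> indeps M"
    and indep_augment: "X \<in> indeps M \<Longrightarrow> Y \<in> indeps M \<Longrightarrow> card X < card Y \<Longrightarrow>
      \<exists>y\<in>Y - X. insert y X \<in> indeps M"

definition is_basis :: "'a indep_system \<Rightarrow> 'a set \<Rightarrow> bool" where
  "is_basis M B \<longleftrightarrow> B \<in> indeps M \<and> (\<forall>X\<in>indeps M. B \<subseteq> X \<longrightarrow> X = B)"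

definition is_circuit :: "'a indep_system \<Rightarrow> 'a set \<Rightarrow> bool" where
  "is_circuit M C \<longleftrightarrow> C \<subseteq> ground M \<and> C \<notin> indeps M \<and> (\<forall>X. X \<subset> C \<longrightarrow> X \<in> indeps M)"

text \<open>The bases of the dual are the complements of the bases.\<close>
definition dual :: "'a indep_system \<Rightarrow> 'a indep_system" where
  "dual M = Indep_System (ground M) {X. \<exists>B. is_basis M B \<and> X \<subseteq> ground M - B}"

definition is_cocircuit :: "'a indep_system \<Rightarrow> 'a set \<Rightarrow> bool" where
  "is_cocircuit M C \<longleftrightarrow> is_circuit (dual M) C"

definition delete :: "'a indep_system \<Rightarrow> 'a set \<Rightarrow> 'a indep_system" where
  "delete M D = Indep_System (ground M - D) {X \<in> indeps M. X \<subseteq> ground M - D}"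

definition contract :: "'a indep_system \<Rightarrow> 'a set \<Rightarrow> 'a indep_system" where
  "contract M C = dual (delete (dual M) C)"

definition is_minor :: "'a indep_system \<Rightarrow> 'a indep_system \<Rightarrow> bool" where
  "is_minor N M \<longleftrightarrow> (\<exists>C D. C \<subseteq> ground M \<and> D \<subseteq> ground M \<and> C \<inter> D = {} \<and> N = delete (contract M C) D)"

definition isomorphic :: "'a indep_system \<Rightarrow> 'b indep_system \<Rightarrow> bool" where
  "isomorphic M N \<longleftrightarrow> (\<exists>f. bij_betw f (ground M) (ground N) \<and>
     (\<forall>X. X \<subseteq> ground M \<longrightarrow> (X \<in> indeps M \<longleftrightarrow> f ` X \<in> indeps N)))"

definition uniform :: "nat \<Rightarrow> nat \<Rightarrow> nat indep_system" where
  "uniform r n = Indep_System {..<n} {X. X \<subseteq> {..<n} \<and> card X \<le> r}"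

definition direct_sum :: "'a indep_system \<Rightarrow> 'b indep_system \<Rightarrow> ('a + 'b) indep_system" where
  "direct_sum M N = Indep_System (ground M <+> ground N) {X <+> Y | X Y. X \<in> indeps M \<and> Y \<in> indeps N}"

definition kl_uniform :: "nat \<Rightarrow> nat \<Rightarrow> 'a indep_system \<Rightarrow> bool" where
  "kl_uniform k l M \<longleftrightarrow>
     \<not> (\<exists>N. is_minor N M \<and> isomorphic N (direct_sum (uniform k k) (uniform 0 l)))"

text \<open>The relation \<open>r\<close> is a total order on the ground set; \<open>(u, v) \<in> r\<close> means that \<open>u\<close> is
  smaller than or equal to \<open>v\<close>.\<close>
definition is_smallest :: "'a rel \<Rightarrow> 'a \<Rightarrow> 'a set \<Rightarrow> bool" where
  "is_smallest r v C \<longleftrightarrow> v \<in> C \<and> (\<forall>u\<in>C. (v, u) \<in> r)"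

text \<open>If \<open>B\<close> is a basis of a matroid, then exactly one circuit is contained in \<open>insert v B\<close> for
  \<open>v \<in> ground M - B\<close>, and exactly one cocircuit in \<open>insert v (ground M - B)\<close> for \<open>v \<in> B\<close>.\<close>
definition fund_circuit :: "'a indep_system \<Rightarrow> 'a set \<Rightarrow> 'a \<Rightarrow> 'a set" where
  "fund_circuit M B v = (THE C. is_circuit M C \<and> C \<subseteq> insert v B)"

definition fund_cocircuit :: "'a indep_system \<Rightarrow> 'a set \<Rightarrow> 'a \<Rightarrow> 'a set" where
  "fund_cocircuit M B v = (THE C. is_cocircuit M C \<and> C \<subseteq> insert v (ground M - B))"

definition int_activity :: "'a indep_system \<Rightarrow> 'a rel \<Rightarrow> 'a set \<Rightarrow> nat" where
  "int_activity M r B = card {v \<in> B. is_smallest r v (fund_cocircuit M B v)}"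

definition ext_activity :: "'a indep_system \<Rightarrow> 'a rel \<Rightarrow> 'a set \<Rightarrow> nat" where
  "ext_activity M r B = card {v \<in> ground M - B. is_smallest r v (fund_circuit M B v)}"

text \<open>A polynomial in \<open>x\<close> whose coefficients are polynomials in \<open>y\<close>: the summand below is
  \<open>x ^ int_activity M r B * y ^ ext_activity M r B\<close>. For a matroid it does not depend on
  the total order \<open>r\<close>.\<close>
definition tutte_poly :: "'a indep_system \<Rightarrow> 'a rel \<Rightarrow> int poly poly" where
  "tutte_poly M r =
     (\<Sum>B | is_basis M B. monom (monom 1 (ext_activity M r B)) (int_activity M r B))"

definition tutte_coeff :: "'a indep_system \<Rightarrow> 'a rel \<Rightarrow> nat \<Rightarrow> nat \<Rightarrow> int" where
  "tutte_coeff M r i j = coeff (coeff (tutte_poly M r) i) j"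

end

theory Submission
  imports Defs
begin

text \<open>Call \<open>(B, I, J)\<close> a configuration if \<open>B\<close> is a basis, \<open>I \<subseteq> B\<close>, \<open>J\<close> is disjoint from \<open>B\<close>,
  and every element of \<open>J\<close> is spanned by \<open>B - I\<close>. Contracting \<open>B - I\<close> and deleting everything
  else outside \<open>I \<union> J\<close> leaves \<open>I\<close> as coloops and \<open>J\<close> as loops, and every minor consisting of
  loops and coloops arises from such a configuration. If \<open>B\<close> is any basis, its internally active
  elements \<open>I\<close> and externally active elements \<open>J\<close> form a configuration, because \<open>e\<close> lies in the
  fundamental circuit of \<open>v\<close> iff \<open>v\<close> lies in the fundamental cocircuit of \<open>e\<close>, and then both
  cannot be smallest. Conversely, among the configurations with given \<open>card I\<close> and \<open>card J\<close>
  choose one whose elements of \<open>I \<union> J\<close> come as early in the order as possible: if some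
  \<open>e \<in> I\<close> were not internally active, exchanging it for a smaller element of its fundamental
  cocircuit would give a better configuration, and likewise for \<open>J\<close>. This avoids
  the independence of the Tutte polynomial from the order.\<close>

section \<open>Matroids: bases, duality, fundamental circuits and contraction\<close>

lemma ground_dual [simp]: "ground (dual M) = ground M"
  by (simp add: dual_def)

lemma indeps_dual: "X \<in> indeps (dual M) \<longleftrightarrow> (\<exists>B. is_basis M B \<and> X \<subseteq> ground M - B)"
  by (simp add: dual_def)

context matroid
begin

section \<open>Bases and maximal independent sets\<close>

lemma finite_indep: "X \<in> indeps M \<Longrightarrow> finite X"
  using indep_subset_ground finite_ground finite_subset by blast

lemma basis_indep: "is_basis M B \<Longrightarrow> B \<in> indeps M"
  by (simp add: is_basis_def)

lemma finite_basis: "is_basis M B \<Longrightarrow> finite B"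
  by (simp add: basis_indep finite_indep)

lemma basis_subset_ground: "is_basis M B \<Longrightarrow> B \<subseteq> ground M"
  by (simp add: basis_indep indep_subset_ground)

lemma insert_basis_dependent: "is_basis M B \<Longrightarrow> v \<notin> B \<Longrightarrow> insert v B \<notin> indeps M"
  unfolding is_basis_def by blast

lemma card_indep_le_basis:
  assumes "is_basis M B" "X \<in> indeps M"
  shows "card X \<le> card B"
proof (rule ccontr)
  assume "\<not> card X \<le> card B"
  then obtain y where "y \<in> X - B" "insert y B \<in> indeps M"
    using assms indep_augment[OF basis_indep] by fastforce
  with insert_basis_dependent assms show False by auto
qed

lemma basis_card_eq: "is_basis M B \<Longrightarrow> is_basis M B' \<Longrightarrow> card B = card B'"
  using card_indep_le_basis basis_indep by (metis le_antisym)

lemma indep_card_imp_basis: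
  assumes "is_basis M B" "X \<in> indeps M" "card B \<le> card X"
  shows "is_basis M X"
  unfolding is_basis_def
proof (intro conjI ballI impI)
  fix Y assume "Y \<in> indeps M" "X \<subseteq> Y"
  moreover from this have "card Y \<le> card X"
    using assms card_indep_le_basis le_trans by blast
  ultimately show "Y = X" using card_seteq finite_indep by metis
qed fact

lemma max_indep_exists:
  assumes "X \<in> indeps M" "X \<subseteq> S"
  obtains K where "K \<in> indeps M" "X \<subseteq> K" "K \<subseteq> S"
    "\<And>Y. Y \<in> indeps M \<Longrightarrow> K \<subseteq> Y \<Longrightarrow> Y \<subseteq> S \<Longrightarrow> Y = K"
proof -
  let ?F = "{K \<in> indeps M. X \<subseteq> K \<and> K \<subseteq> S}"
  have "?F \<subseteq> Pow (ground M)" using indep_subset_ground by auto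
  then have "finite ?F" using finite_ground finite_subset by blast
  moreover have "X \<in> ?F" using assms by simp
  ultimately obtain K where "K \<in> ?F" "\<forall>Y\<in>?F. K \<subseteq> Y \<longrightarrow> K = Y"
    using finite_has_maximal[of ?F] by blast
  then show thesis by (intro that[of K]) auto
qed

text \<open>A single maximal independent subset realises the rank of \<open>S\<close>: a larger
  independent \<open>X\<close> would augment \<open>K\<close> without leaving
  \<open>S\<close>.\<close>

lemma max_indep_card_le:
  assumes "K \<in> indeps M" "\<And>Y. Y \<in> indeps M \<Longrightarrow> K \<subseteq> Y \<Longrightarrow> Y \<subseteq> S \<Longrightarrow> Y = K" "K \<subseteq> S"
    and "X \<in> indeps M" "X \<subseteq> S"
  shows "card X \<le> card K"
proof (rule ccontr)
  assume "\<not> card X \<le> card K"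
  then obtain y where "y \<in> X - K" "insert y K \<in> indeps M"
    using indep_augment assms by (meson not_le_imp_less)
  with assms(2)[of "insert y K"] assms(3,5) show False by auto
qed

text \<open>Maximality is taken inside \<open>X \<union> B\<close>, so new elements come only from
  the given basis. The arguments on duals, fundamental circuits and contractions rely on this
  control.\<close>

lemma extend_to_basis:
  assumes "X \<in> indeps M" "is_basis M B"
  obtains B' where "is_basis M B'" "X \<subseteq> B'" "B' \<subseteq> X \<union> B"
proof -
  obtain K where K: "K \<in> indeps M" "X \<subseteq> K" "K \<subseteq> X \<union> B"
    "\<And>Y. Y \<in> indeps M \<Longrightarrow> K \<subseteq> Y \<Longrightarrow> Y \<subseteq> X \<union> B \<Longrightarrow> Y = K"
    using max_indep_exists[OF assms(1), of "X \<union> B"] by blast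
  have "card B \<le> card K"
    using max_indep_card_le[OF K(1) K(4) K(3)] basis_indep[OF assms(2)] by blast
  then show thesis using that K indep_card_imp_basis assms by blast
qed

lemma basis_exists: obtains B where "is_basis M B"
proof -
  obtain K where "K \<in> indeps M" "\<And>Y. Y \<in> indeps M \<Longrightarrow> K \<subseteq> Y \<Longrightarrow> Y \<subseteq> UNIV \<Longrightarrow> Y = K"
    by (rule max_indep_exists[OF indep_empty subset_UNIV]) (rule that, auto)
  then show thesis by (intro that[of K]) (auto simp: is_basis_def)
qed

section \<open>Duality\<close>

text \<open>If no element of \<open>Y\<close> augments \<open>X\<close>, then every basis that
  avoids \<open>X\<close> contains \<open>Y - X\<close>. A basis \<open>B\<^sub>3\<close> that
  avoids \<open>X\<close> and contains \<open>B\<^sub>2 - X\<close> is then too large.\<close>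

lemma matroid_dual: "matroid (dual M)"
proof
  show "finite (ground (dual M))" using finite_ground by simp
  show "X \<subseteq> ground (dual M)" if "X \<in> indeps (dual M)" for X
    using that by (auto simp: indeps_dual)
  show "{} \<in> indeps (dual M)"
    using basis_exists by (auto simp: indeps_dual)
  show "Y \<in> indeps (dual M)" if "X \<in> indeps (dual M)" "Y \<subseteq> X" for X Y
    using that unfolding indeps_dual by blast
  show "\<exists>y\<in>Y - X. insert y X \<in> indeps (dual M)"
    if X: "X \<in> indeps (dual M)" and Y: "Y \<in> indeps (dual M)" and less: "card X < card Y" for X Y
  proof (rule ccontr)
    assume none: "\<not> ?thesis"
    obtain B\<^sub>1 where B1: "is_basis M B\<^sub>1" "X \<subseteq> ground M - B\<^sub>1" using X by (auto simp: indeps_dual)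
    obtain B\<^sub>2 where B2: "is_basis M B\<^sub>2" "Y \<subseteq> ground M - B\<^sub>2" using Y by (auto simp: indeps_dual)
    have "B\<^sub>2 - X \<in> indeps M" using B2 basis_indep indep_subset by blast
    then obtain B\<^sub>3 where B3: "is_basis M B\<^sub>3" "B\<^sub>2 - X \<subseteq> B\<^sub>3" "B\<^sub>3 \<subseteq> (B\<^sub>2 - X) \<union> B\<^sub>1"
      using extend_to_basis B1(1) by blast
    have "Y - X \<subseteq> B\<^sub>3"
    proof
      fix y assume y: "y \<in> Y - X"
      show "y \<in> B\<^sub>3"
      proof (rule ccontr)
        assume "y \<notin> B\<^sub>3"
        \<comment> \<open>\<open>B\<^sub>3\<close> avoids \<open>X\<close>, because
          \<open>B\<^sub>1\<close> does.\<close>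
        then have "insert y X \<subseteq> ground M - B\<^sub>3" using B1 B2 B3 y by blast
        then show False using none y B3(1) by (auto simp: indeps_dual)
      qed
    qed
    have fin: "finite X" "finite Y" "finite B\<^sub>2" "finite B\<^sub>3"
      using B1 B2 B3 finite_ground finite_basis by (auto intro: finite_subset)
    \<comment> \<open>Since \<open>Y\<close> avoids \<open>B\<^sub>2\<close>, the count gives
      \<open>card (Y - X) > card (X - Y) \<ge> card (B\<^sub>2 \<inter> X)\<close>. So the disjoint
      sets \<open>B\<^sub>2 - X\<close> and \<open>Y - X\<close> together have more elements than a
      basis.\<close>
    have "card X + card (Y - X) = card Y + card (X - Y)"
      using card_Un_disjoint[of X "Y - X"] card_Un_disjoint[of Y "X - Y"] fin
      by (simp add: Un_commute)
    moreover have "card (B\<^sub>2 \<inter> X) \<le> card (X - Y)"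
      using B2 fin by (intro card_mono) auto
    moreover have "card B\<^sub>2 = card (B\<^sub>2 \<inter> X) + card (B\<^sub>2 - X)"
      using fin card_Int_Diff by blast
    moreover have "card (B\<^sub>2 - X) + card (Y - X) = card ((B\<^sub>2 - X) \<union> (Y - X))"
      using B2 fin by (intro card_Un_disjoint[symmetric]) auto
    moreover have "card ((B\<^sub>2 - X) \<union> (Y - X)) \<le> card B\<^sub>3"
      using B3(2) \<open>Y - X \<subseteq> B\<^sub>3\<close> fin by (intro card_mono) auto
    moreover have "card B\<^sub>3 = card B\<^sub>2" using B2 B3 basis_card_eq by blast
    ultimately show False using less by linarith
  qed
qed

lemma basis_dual:
  assumes "is_basis M B"
  shows "is_basis (dual M) (ground M - B)"
  unfolding is_basis_def
proof (intro conjI ballI impI)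
  show "ground M - B \<in> indeps (dual M)" using assms by (auto simp: indeps_dual)
  fix X assume X: "X \<in> indeps (dual M)" "ground M - B \<subseteq> X"
  then obtain B' where B': "is_basis M B'" "X \<subseteq> ground M - B'" by (auto simp: indeps_dual)
  then have "B' \<subseteq> B" using X basis_subset_ground by blast
  then have "B' = B" using assms B' unfolding is_basis_def by blast
  then show "X = ground M - B" using X B' by blast
qed

section \<open>Fundamental circuits, fundamental cocircuits and basis exchange\<close>

text \<open>A circuit inside \<open>insert v B\<close> cannot miss an element whose removal restores
  independence. The set of all such elements is itself dependent, so it is the only circuit
  there.\<close>

lemma fund_circuit_eq:
  assumes B: "is_basis M B" and v: "v \<in> ground M - B"
  shows "fund_circuit M B v = {u \<in> insert v B. insert v B - {u} \<in> indeps M}"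
    and "is_circuit M (fund_circuit M B v)"
proof -
  define C where "C = {u \<in> insert v B. insert v B - {u} \<in> indeps M}"
  have dep: "C \<notin> indeps M"
  \<comment> \<open>An independent \<open>C\<close> would extend to a basis \<open>Z\<close> inside
    \<open>insert v B\<close>. By cardinality \<open>Z\<close> omits exactly one element
    \<open>u\<close>, which then belongs to \<open>C\<close> and hence to \<open>Z\<close>.\<close>
  proof
    assume C: "C \<in> indeps M"
    have "v \<in> C" using B v basis_indep by (simp add: C_def)
    obtain Z where Z: "is_basis M Z" "C \<subseteq> Z" "Z \<subseteq> C \<union> B"
      using extend_to_basis[OF C B] by blast
    then have sub: "Z \<subseteq> insert v B" by (auto simp: C_def)
    have "Z \<noteq> insert v B" using Z(1) insert_basis_dependent B v basis_indep by auto
    then obtain u where u: "u \<in> insert v B" "u \<notin> Z" using sub by blast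
    have "card Z = card (insert v B - {u})"
      using u v finite_basis[OF B] basis_card_eq[OF Z(1) B] by simp
    then have "Z = insert v B - {u}"
      using sub u B finite_basis by (intro card_subset_eq) auto
    then have "u \<in> C" using Z(1) basis_indep u by (simp add: C_def)
    then show False using Z(2) u by blast
  qed
  have circ: "is_circuit M C"
    unfolding is_circuit_def
  proof (intro conjI allI impI)
    show "C \<subseteq> ground M" using v B basis_subset_ground by (auto simp: C_def)
    fix X assume "X \<subset> C"
    then obtain u where "u \<in> C" "X \<subseteq> insert v B - {u}" by (auto simp: C_def)
    then show "X \<in> indeps M" using indep_subset by (auto simp: C_def)
  qed (fact dep)
  have uniq: "C' = C" if C': "is_circuit M C'" "C' \<subseteq> insert v B" for C'
  proof -
    have "C \<subseteq> C'"
    proof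
      fix u assume u: "u \<in> C"
      show "u \<in> C'"
      proof (rule ccontr)
        assume "u \<notin> C'"
        then have "C' \<subseteq> insert v B - {u}" using C' by blast
        then show False using C' u indep_subset by (auto simp: C_def is_circuit_def)
      qed
    qed
    then show ?thesis using C' dep unfolding is_circuit_def by blast
  qed
  have "fund_circuit M B v = C"
    unfolding fund_circuit_def using circ uniq by (intro the_equality) (auto simp: C_def)
  then show "fund_circuit M B v = {u \<in> insert v B. insert v B - {u} \<in> indeps M}"
    and "is_circuit M (fund_circuit M B v)" using circ by (auto simp: C_def)
qed

text \<open>Membership becomes basis exchange. Compared with the cocircuit version below, this
  yields the symmetry between fundamental circuits and cocircuits.\<close>

lemma mem_fund_circuit_iff:
  assumes B: "is_basis M B" and v: "v \<in> ground M - B"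
  shows "u \<in> fund_circuit M B v \<longleftrightarrow> u = v \<or> u \<in> B \<and> is_basis M (insert v (B - {u}))"
proof (cases "u \<in> B")
  case True
  then have eq: "insert v B - {u} = insert v (B - {u})" using v by blast
  have "card B = card (insert v (B - {u}))"
    using True v finite_basis[OF B] card_Suc_Diff1[of B u] by simp
  then have "is_basis M (insert v (B - {u})) \<longleftrightarrow> insert v (B - {u}) \<in> indeps M"
    using basis_indep indep_card_imp_basis[OF B] by auto
  then show ?thesis using True v eq fund_circuit_eq(1)[OF assms] by auto
next
  case False
  then show ?thesis using v B basis_indep fund_circuit_eq(1)[OF assms] by auto
qed

text \<open>The fundamental cocircuit is the fundamental circuit of the complementary basis in
  \<open>dual M\<close>; complements turn exchange there into exchange in \<open>M\<close>.\<close>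

lemma mem_fund_cocircuit_iff:
  assumes B: "is_basis M B" and v: "v \<in> B"
  shows "u \<in> fund_cocircuit M B v \<longleftrightarrow>
    u = v \<or> u \<in> ground M - B \<and> is_basis M (insert u (B - {v}))"
proof -
  interpret D: matroid "dual M" by (rule matroid_dual)
  have "fund_cocircuit M B v = fund_circuit (dual M) (ground M - B) v"
    by (simp add: fund_cocircuit_def fund_circuit_def is_cocircuit_def)
  moreover have "v \<in> ground (dual M) - (ground M - B)"
    using B v basis_subset_ground by auto
  ultimately have 1: "u \<in> fund_cocircuit M B v \<longleftrightarrow>
      u \<in> insert v (ground M - B) \<and> insert v (ground M - B) - {u} \<in> indeps (dual M)"
    using D.fund_circuit_eq(1)[OF basis_dual[OF B]] by auto
  show ?thesis
  proof (cases "u \<in> ground M - B")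
    case True
    have "insert v (ground M - B) - {u} \<in> indeps (dual M) \<longleftrightarrow> is_basis M (insert u (B - {v}))"
    proof
      assume "insert v (ground M - B) - {u} \<in> indeps (dual M)"
      then obtain B' where B': "is_basis M B'" "insert v (ground M - B) - {u} \<subseteq> ground M - B'"
        by (auto simp: indeps_dual)
      then have "B' \<subseteq> insert u (B - {v})" using basis_subset_ground[OF B'(1)] v True by blast
      moreover have "card B' = card (insert u (B - {v}))"
        using True v finite_basis[OF B] basis_card_eq[OF B B'(1)] card_Suc_Diff1[of B v] by simp
      ultimately have "B' = insert u (B - {v})"
        using finite_basis[OF B] by (intro card_subset_eq) auto
      then show "is_basis M (insert u (B - {v}))" using B' by simp
    next
      assume "is_basis M (insert u (B - {v}))"
      then show "insert v (ground M - B) - {u} \<in> indeps (dual M)"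
        using True v basis_subset_ground[OF B] by (auto simp: indeps_dual)
    qed
    then show ?thesis using 1 True v by auto
  next
    case False
    then show ?thesis using 1 B v basis_dual[OF B] D.basis_indep by auto
  qed
qed

section \<open>Contraction\<close>

text \<open>This recovers the usual description from the definition by duality. The bases of
  \<open>delete (dual M) C\<close> are the sets \<open>ground M - C - B\<^sub>0\<close> for bases
  \<open>B\<^sub>0\<close> of \<open>M\<close> that contain \<open>K\<close>.\<close>

lemma indeps_contract:
  assumes C: "C \<subseteq> ground M"
    and K: "K \<in> indeps M" "K \<subseteq> C" "\<And>Y. Y \<in> indeps M \<Longrightarrow> K \<subseteq> Y \<Longrightarrow> Y \<subseteq> C \<Longrightarrow> Y = K"
  shows "X \<in> indeps (contract M C) \<longleftrightarrow> X \<subseteq> ground M - C \<and> X \<union> K \<in> indeps M"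
proof -
  let ?N = "delete (dual M) C"
  have indN: "Y \<in> indeps ?N \<longleftrightarrow> Y \<in> indeps (dual M) \<and> Y \<subseteq> ground M - C" for Y
    by (simp add: delete_def)
  have "X \<in> indeps (contract M C) \<longleftrightarrow> (\<exists>S. is_basis ?N S \<and> X \<subseteq> ground M - C - S)"
    by (simp add: contract_def indeps_dual) (simp add: delete_def)
  also have "\<dots> \<longleftrightarrow> X \<subseteq> ground M - C \<and> X \<union> K \<in> indeps M"
  proof
    assume "\<exists>S. is_basis ?N S \<and> X \<subseteq> ground M - C - S"
    then obtain S where S: "is_basis ?N S" "X \<subseteq> ground M - C - S" by blast
    then have SN: "S \<in> indeps (dual M)" "S \<subseteq> ground M - C"
      by (auto simp: is_basis_def indN)
    then obtain B where B: "is_basis M B" "S \<subseteq> ground M - B" by (auto simp: indeps_dual)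
    obtain B\<^sub>0 where B0: "is_basis M B\<^sub>0" "K \<subseteq> B\<^sub>0" "B\<^sub>0 \<subseteq> K \<union> B"
      using extend_to_basis[OF K(1) B(1)] by blast
    have "ground M - C - B\<^sub>0 \<in> indeps ?N" using B0 by (auto simp: indN indeps_dual)
    moreover have "S \<subseteq> ground M - C - B\<^sub>0" using SN B(2) B0(3) K(2) by blast
    ultimately have "ground M - C - B\<^sub>0 = S" using S(1) unfolding is_basis_def by blast
    then have "X \<union> K \<subseteq> B\<^sub>0" using S(2) B0(2) by blast
    then show "X \<subseteq> ground M - C \<and> X \<union> K \<in> indeps M"
      using S(2) B0(1) basis_indep indep_subset by blast
  next
    assume X: "X \<subseteq> ground M - C \<and> X \<union> K \<in> indeps M"
    obtain B where B: "is_basis M B" by (rule basis_exists)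
    obtain B\<^sub>0 where B0: "is_basis M B\<^sub>0" "X \<union> K \<subseteq> B\<^sub>0"
      by (rule extend_to_basis[OF conjunct2[OF X] B])
    have "is_basis ?N (ground M - C - B\<^sub>0)"
      unfolding is_basis_def
    proof (intro conjI ballI impI)
      show "ground M - C - B\<^sub>0 \<in> indeps ?N" using B0 by (auto simp: indN indeps_dual)
      fix Y assume Y: "Y \<in> indeps ?N" "ground M - C - B\<^sub>0 \<subseteq> Y"
      then obtain B\<^sub>1 where B1: "is_basis M B\<^sub>1" "Y \<subseteq> ground M - B\<^sub>1" "Y \<subseteq> ground M - C"
        by (auto simp: indN indeps_dual)
      have sub: "B\<^sub>1 - C \<subseteq> B\<^sub>0 - C" using B1 Y basis_subset_ground by blast
      \<comment> \<open>No basis meets \<open>C\<close> in more than \<open>card K\<close> elements.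
        All bases have the same size, so \<open>B\<^sub>1\<close> has at least as many elements
        outside \<open>C\<close> as \<open>B\<^sub>0\<close>.\<close>
      have "B\<^sub>1 \<inter> C \<in> indeps M" using B1 basis_indep indep_subset by blast
      then have "card (B\<^sub>1 \<inter> C) \<le> card K" using max_indep_card_le[OF K(1,3,2)] by blast
      also have "card K \<le> card (B\<^sub>0 \<inter> C)"
        using B0 K(2) finite_basis by (intro card_mono) auto
      finally have "card (B\<^sub>1 \<inter> C) \<le> card (B\<^sub>0 \<inter> C)" .
      moreover have "card B\<^sub>0 = card (B\<^sub>0 \<inter> C) + card (B\<^sub>0 - C)"
        "card B\<^sub>1 = card (B\<^sub>1 \<inter> C) + card (B\<^sub>1 - C)"
        using B0 B1 finite_basis card_Int_Diff by blast+
      ultimately have "card (B\<^sub>0 - C) \<le> card (B\<^sub>1 - C)"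
        using basis_card_eq[OF B0(1) B1(1)] by linarith
      then have "B\<^sub>1 - C = B\<^sub>0 - C"
        using sub B0 finite_basis by (intro card_seteq) auto
      then show "Y = ground M - C - B\<^sub>0" using Y(2) B1 by blast
    qed
    then show "\<exists>S. is_basis ?N S \<and> X \<subseteq> ground M - C - S" using X B0(2) by blast
  qed
  finally show ?thesis .
qed

end

section \<open>Configurations, minors and activities\<close>

lemma ground_contract [simp]: "ground (contract M C) = ground M - C"
  by (simp add: contract_def delete_def)

section \<open>Matroids consisting of coloops and loops\<close>

lemma indeps_coloops_loops:
  "indeps (direct_sum (uniform k k) (uniform 0 l)) = Pow (Inl ` {..<k})"
proof -
  have "Y \<subseteq> {..<l} \<and> card Y \<le> 0 \<longleftrightarrow> Y = {}" for Y :: "nat set"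
    by (metis card.empty card_0_eq empty_subsetI finite_lessThan finite_subset le_0_eq order_refl)
  moreover have "X \<subseteq> {..<k} \<and> card X \<le> k \<longleftrightarrow> X \<subseteq> {..<k}" for X :: "nat set"
    by (metis card_lessThan card_mono finite_lessThan)
  ultimately have "indeps (direct_sum (uniform k k) (uniform 0 l)) = {X <+> {} | X. X \<subseteq> {..<k}}"
    by (simp add: direct_sum_def uniform_def)
  also have "\<dots> = {Inl ` X | X. X \<subseteq> {..<k}}"
    by (simp add: Plus_def)
  also have "\<dots> = Pow (Inl ` {..<k})"
    by (auto simp only: Pow_def subset_image_iff)
  finally show ?thesis .
qed

text \<open>An isomorphism only has to respect the partition into coloops and loops, so just the two
  cardinalities matter. The hypothesis is there because \<open>isomorphic\<close> constrains only
  subsets of the ground set.\<close>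

lemma isomorphic_coloops_loops_iff:
  assumes "indeps N \<subseteq> Pow (ground N)"
  shows "isomorphic N (direct_sum (uniform k k) (uniform 0 l)) \<longleftrightarrow>
    (\<exists>I J. ground N = I \<union> J \<and> I \<inter> J = {} \<and> finite I \<and> finite J \<and> card I = k \<and> card J = l \<and>
      indeps N = Pow I)"
proof -
  let ?U = "direct_sum (uniform k k) (uniform 0 l)"
  have gU: "ground ?U = Inl ` {..<k} \<union> Inr ` {..<l}"
    by (simp add: direct_sum_def uniform_def Plus_def)
  show ?thesis
  proof
    assume "isomorphic N ?U"
    then obtain f where f: "bij_betw f (ground N) (ground ?U)"
      "\<And>X. X \<subseteq> ground N \<Longrightarrow> X \<in> indeps N \<longleftrightarrow> f ` X \<in> indeps ?U"
      unfolding isomorphic_def by blast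
    define I where "I = {x \<in> ground N. f x \<in> Inl ` {..<k}}"
    define J where "J = {x \<in> ground N. f x \<in> Inr ` {..<l}}"
    have img: "f ` ground N = Inl ` {..<k} \<union> Inr ` {..<l}"
      using f(1) gU by (simp add: bij_betw_def)
    have "f ` I = f ` ground N \<inter> Inl ` {..<k}" "f ` J = f ` ground N \<inter> Inr ` {..<l}"
      by (auto simp: I_def J_def)
    then have "f ` I = Inl ` {..<k}" "f ` J = Inr ` {..<l}"
      unfolding img by auto
    moreover have "inj_on f I" "inj_on f J"
      using f(1) by (auto simp: bij_betw_def I_def J_def intro: inj_on_subset)
    ultimately have bI: "bij_betw f I (Inl ` {..<k})" and bJ: "bij_betw f J (Inr ` {..<l})"
      by (auto simp: bij_betw_def)
    have "finite I" "finite J" using bij_betw_finite[OF bI] bij_betw_finite[OF bJ] by simp_all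
    moreover have "card I = k" "card J = l"
      using bij_betw_same_card[OF bI] bij_betw_same_card[OF bJ] by (simp_all add: card_image)
    moreover have "ground N = I \<union> J" "I \<inter> J = {}" using img by (auto simp: I_def J_def)
    moreover have "indeps N = Pow I"
    proof (intro set_eqI)
      fix X
      have "X \<in> indeps N \<longleftrightarrow> X \<subseteq> ground N \<and> f ` X \<subseteq> Inl ` {..<k}"
        using assms f(2)[of X] by (auto simp: indeps_coloops_loops)
      also have "\<dots> \<longleftrightarrow> X \<in> Pow I" by (auto simp: I_def)
      finally show "X \<in> indeps N \<longleftrightarrow> X \<in> Pow I" .
    qed
    ultimately show "\<exists>I J. ground N = I \<union> J \<and> I \<inter> J = {} \<and> finite I \<and> finite J \<and>
      card I = k \<and> card J = l \<and> indeps N = Pow I" by blast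
  next
    assume "\<exists>I J. ground N = I \<union> J \<and> I \<inter> J = {} \<and> finite I \<and> finite J \<and>
      card I = k \<and> card J = l \<and> indeps N = Pow I"
    then obtain I J where IJ: "ground N = I \<union> J" "I \<inter> J = {}" "finite I" "finite J"
      "card I = k" "card J = l" "indeps N = Pow I" by blast
    obtain g h where gh: "bij_betw g I {..<k}" "bij_betw h J {..<l}"
      using IJ by (metis bij_betw_iff_card finite_lessThan card_lessThan)
    define f where "f x = (if x \<in> I then Inl (g x) else Inr (h x))" for x
    have "f ` I = Inl ` g ` I" by (auto simp: f_def image_image)
    then have fI: "f ` I = Inl ` {..<k}" using gh(1) by (simp add: bij_betw_def)
    have "f x = Inr (h x)" if "x \<in> J" for x
      using that IJ(2) by (auto simp: f_def)
    then have "f ` J = Inr ` h ` J" by (auto simp: image_image)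
    then have fJ: "f ` J = Inr ` {..<l}" using gh(2) by (simp add: bij_betw_def)
    have "inj_on f (I \<union> J)"
      using bij_betw_imp_inj_on[OF gh(1)] bij_betw_imp_inj_on[OF gh(2)]
      by (auto simp: f_def inj_on_def)
    then have "bij_betw f (ground N) (ground ?U)"
      using fI fJ IJ(1) gU by (simp add: bij_betw_def image_Un)
    moreover have "X \<in> indeps N \<longleftrightarrow> f ` X \<in> indeps ?U" if "X \<subseteq> ground N" for X
    proof -
      have "f ` X \<subseteq> Inl ` {..<k} \<longleftrightarrow> X \<subseteq> I"
      proof
        assume "f ` X \<subseteq> Inl ` {..<k}"
        then show "X \<subseteq> I" by (force simp: f_def split: if_splits)
      qed (use fI in blast)
      then show ?thesis by (simp add: IJ(7) indeps_coloops_loops)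
    qed
    ultimately show "isomorphic N ?U" unfolding isomorphic_def by blast
  qed
qed

section \<open>Configurations and minors\<close>

text \<open>As \<open>B - I\<close> is independent and misses \<open>v\<close>, dependence of
  \<open>insert v (B - I)\<close> expresses that \<open>B - I\<close> spans
  \<open>v\<close>.\<close>

definition config :: "'a indep_system \<Rightarrow> 'a set \<Rightarrow> 'a set \<Rightarrow> 'a set \<Rightarrow> bool" where
  "config M B I J \<longleftrightarrow> is_basis M B \<and> I \<subseteq> B \<and> J \<subseteq> ground M - B \<and>
     (\<forall>v\<in>J. insert v (B - I) \<notin> indeps M)"

context matroid
begin

lemma config_iff_minor:
  "(\<exists>B I J. config M B I J \<and> card I = k \<and> card J = l) \<longleftrightarrow> \<not> kl_uniform k l M"
proof
  assume "\<exists>B I J. config M B I J \<and> card I = k \<and> card J = l"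
  then obtain B I J where cfg: "config M B I J" and card: "card I = k" "card J = l" by blast
  then have B: "is_basis M B" and I: "I \<subseteq> B" and J: "J \<subseteq> ground M - B"
    and dep: "\<And>v. v \<in> J \<Longrightarrow> insert v (B - I) \<notin> indeps M" by (auto simp: config_def)
  define C where "C = B - I"
  define D where "D = ground M - B - J"
  define N where "N = delete (contract M C) D"
  have C: "C \<subseteq> ground M" "C \<in> indeps M"
    using basis_subset_ground[OF B] indep_subset[OF basis_indep[OF B]] by (auto simp: C_def)
  have ground: "ground N = I \<union> J"
    using I J basis_subset_ground[OF B] by (auto simp: N_def delete_def C_def D_def)
  \<comment> \<open>\<open>C\<close> is independent, so it is its own maximal independent subset and
    plays the role of \<open>K\<close>.\<close>
  have ind: "X \<in> indeps N \<longleftrightarrow> X \<subseteq> I \<union> J \<and> X \<union> C \<in> indeps M" for X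
    using ground indeps_contract[OF C(1) C(2), of X] by (auto simp: N_def delete_def)
  have "indeps N = Pow I"
  proof (intro set_eqI iffI)
    fix X assume X: "X \<in> indeps N"
    have "v \<notin> X" if "v \<in> J" for v
    proof
      assume "v \<in> X"
      then have "insert v C \<in> indeps M" using X ind indep_subset[of "X \<union> C"] by auto
      then show False using dep that C_def by blast
    qed
    then show "X \<in> Pow I" using X ind by blast
  next
    fix X assume "X \<in> Pow I"
    then have "X \<union> C \<subseteq> B" using I by (auto simp: C_def)
    then show "X \<in> indeps N" using \<open>X \<in> Pow I\<close> ind B basis_indep indep_subset by blast
  qed
  moreover have "finite I" "finite J" "I \<inter> J = {}"
    using I J B finite_basis finite_ground by (auto intro: finite_subset)
  ultimately have "isomorphic N (direct_sum (uniform k k) (uniform 0 l))"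
    using ground card by (subst isomorphic_coloops_loops_iff) auto
  moreover have "is_minor N M"
    unfolding is_minor_def N_def using C(1)
    by (intro exI[of _ C] exI[of _ D]) (auto simp: C_def D_def)
  ultimately show "\<not> kl_uniform k l M" unfolding kl_uniform_def by blast
next
  assume "\<not> kl_uniform k l M"
  then obtain C D where CD: "C \<subseteq> ground M" "D \<subseteq> ground M" "C \<inter> D = {}"
    and iso: "isomorphic (delete (contract M C) D) (direct_sum (uniform k k) (uniform 0 l))"
    unfolding kl_uniform_def is_minor_def by blast
  define N where "N = delete (contract M C) D"
  have "indeps N \<subseteq> Pow (ground N)" by (auto simp: N_def delete_def)
  from iso[folded N_def, unfolded isomorphic_coloops_loops_iff[OF this]]
  obtain I J where IJ: "ground N = I \<union> J" "I \<inter> J = {}" "card I = k" "card J = l"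
    "indeps N = Pow I" by blast
  obtain K where K: "K \<in> indeps M" "K \<subseteq> C"
    "\<And>Y. Y \<in> indeps M \<Longrightarrow> K \<subseteq> Y \<Longrightarrow> Y \<subseteq> C \<Longrightarrow> Y = K"
    by (rule max_indep_exists[OF indep_empty empty_subsetI[of C]]) (rule that, auto)
  have ground: "I \<union> J = ground M - C - D" using IJ(1) by (simp add: N_def delete_def)
  have ind: "X \<subseteq> I \<longleftrightarrow> X \<union> K \<in> indeps M" if "X \<subseteq> I \<union> J" for X
  proof -
    have "X \<subseteq> I \<longleftrightarrow> X \<in> indeps N" using IJ by simp
    also have "\<dots> \<longleftrightarrow> X \<union> K \<in> indeps M"
      using that ground indeps_contract[OF CD(1) K, of X] by (auto simp: N_def delete_def)
    finally show ?thesis .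
  qed
  have "I \<union> K \<in> indeps M" using ind[of I] by simp
  moreover obtain B\<^sub>0 where "is_basis M B\<^sub>0" by (rule basis_exists)
  ultimately obtain B where B: "is_basis M B" "I \<union> K \<subseteq> B"
    by (rule extend_to_basis)
  \<comment> \<open>The elements of \<open>J\<close> are loops of the minor, so \<open>K\<close>
    already spans them. This keeps \<open>J\<close> out of \<open>B\<close> and, as \<open>K\<close>
    lies in \<open>B - I\<close>, gives the spanning condition.\<close>
  have dep: "insert v K \<notin> indeps M" if "v \<in> J" for v
    using ind[of "{v}"] that IJ(2) by auto
  have "K \<inter> I = {}" using K(2) ground by blast
  have "J \<inter> B = {}"
  proof (rule ccontr)
    assume "J \<inter> B \<noteq> {}"
    then obtain v where "v \<in> J" "insert v K \<subseteq> B" using B by blast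
    then show False using dep B(1) basis_indep indep_subset by blast
  qed
  moreover have "insert v (B - I) \<notin> indeps M" if "v \<in> J" for v
  proof
    assume "insert v (B - I) \<in> indeps M"
    moreover have "insert v K \<subseteq> insert v (B - I)" using B(2) \<open>K \<inter> I = {}\<close> by blast
    ultimately show False using dep[OF that] indep_subset by blast
  qed
  ultimately have "config M B I J" using B ground by (auto simp: config_def)
  then show "\<exists>B I J. config M B I J \<and> card I = k \<and> card J = l" using IJ by blast
qed

section \<open>Exchanges in configurations\<close>

text \<open>The exchange happens inside \<open>I\<close>: removing the new \<open>I\<close> from the
  new basis leaves \<open>B - I\<close> again, so the condition on \<open>J\<close> carries
  over.\<close>

lemma config_exchange_inner:
  assumes cfg: "config M B I J" and e: "e \<in> I"
    and d: "d \<in> ground M - B" and B': "is_basis M (insert d (B - {e}))"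
  shows "config M (insert d (B - {e})) (insert d (I - {e})) J" and "d \<notin> J"
proof -
  have I: "I \<subseteq> B" and J: "J \<subseteq> ground M - B"
    and dep: "\<And>v. v \<in> J \<Longrightarrow> insert v (B - I) \<notin> indeps M"
    using cfg by (auto simp: config_def)
  show "d \<notin> J"
  proof
    assume "d \<in> J"
    moreover have "insert d (B - I) \<subseteq> insert d (B - {e})" using e by blast
    ultimately show False using dep B' basis_indep indep_subset by blast
  qed
  have "insert d (B - {e}) - insert d (I - {e}) = B - I" using e d I by blast
  then show "config M (insert d (B - {e})) (insert d (I - {e})) J"
    using B' I J dep \<open>d \<notin> J\<close> unfolding config_def by auto
qed

text \<open>Here \<open>B - I\<close> does change, with \<open>v\<close> replacing \<open>c\<close>,
  but its span stays the same; \<open>c\<close> becomes spanned in place of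
  \<open>v\<close>.\<close>

lemma config_exchange_outer:
  assumes cfg: "config M B I J" and v: "v \<in> J"
    and c: "c \<in> B" and B': "is_basis M (insert v (B - {c}))"
  shows "config M (insert v (B - {c})) I (insert c (J - {v}))" and "c \<notin> I"
proof -
  have B: "is_basis M B" and I: "I \<subseteq> B" and J: "J \<subseteq> ground M - B"
    and dep: "\<And>v. v \<in> J \<Longrightarrow> insert v (B - I) \<notin> indeps M"
    using cfg by (auto simp: config_def)
  show "c \<notin> I"
  proof
    assume "c \<in> I"
    then have "insert v (B - I) \<subseteq> insert v (B - {c})" by blast
    then show False using dep[OF v] B' basis_indep indep_subset by blast
  qed
  have eq: "insert v (B - {c}) - I = insert v (B - I - {c})" using v I J by blast
  have "insert u (insert v (B - I - {c})) \<notin> indeps M" if u: "u \<in> insert c (J - {v})" for u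
  proof
    assume ind: "insert u (insert v (B - I - {c})) \<in> indeps M"
    show False
    proof (cases "u = c")
      case True
      then have "insert u (insert v (B - I - {c})) = insert v (B - I)"
        using c \<open>c \<notin> I\<close> by blast
      then show False using ind dep[OF v] by simp
    next
      case False
      then have u: "u \<in> J" "u \<noteq> v" using u by auto
      \<comment> \<open>The supposedly independent set has one element more than
        \<open>B - I\<close>, so it would augment \<open>B - I\<close> by \<open>u\<close> or
        \<open>v\<close>. Both lie in \<open>J\<close>, hence are spanned by
        \<open>B - I\<close>.\<close>
      have "u \<notin> insert v (B - I - {c})" "v \<notin> B - I - {c}" using u v J by auto
      then have "card (insert u (insert v (B - I - {c}))) = Suc (card (B - I))"
        using finite_basis[OF B] c \<open>c \<notin> I\<close> card_Suc_Diff1[of "B - I" c] by simp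
      moreover have "B - I \<in> indeps M" using B basis_indep indep_subset by blast
      ultimately obtain y where "y \<in> insert u (insert v (B - I - {c})) - (B - I)"
        "insert y (B - I) \<in> indeps M"
        using indep_augment[OF _ ind, of "B - I"] by auto
      then show False using dep u(1) v by auto
    qed
  qed
  moreover have "insert c (J - {v}) \<subseteq> ground M - insert v (B - {c})"
    using J v c basis_subset_ground[OF B] by blast
  moreover have "I \<subseteq> insert v (B - {c})" using I \<open>c \<notin> I\<close> by blast
  ultimately show "config M (insert v (B - {c})) I (insert c (J - {v}))"
    using B' eq unfolding config_def by simp
qed

section \<open>Configurations and active elements\<close>

lemma config_active:
  assumes r: "antisym r" and B: "is_basis M B"
    and I: "I \<subseteq> {v \<in> B. is_smallest r v (fund_cocircuit M B v)}"
    and J: "J \<subseteq> {v \<in> ground M - B. is_smallest r v (fund_circuit M B v)}"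
  shows "config M B I J"
proof -
  have "insert v (B - I) \<notin> indeps M" if v: "v \<in> J" for v
  proof
    assume ind: "insert v (B - I) \<in> indeps M"
    have vB: "v \<in> ground M - B" and vs: "is_smallest r v (fund_circuit M B v)"
      using v J by auto
    have "fund_circuit M B v \<subseteq> insert v (B - I)"
    proof
      fix e assume e: "e \<in> fund_circuit M B v"
      have "e \<notin> I"
      proof
        assume "e \<in> I"
        then have eB: "e \<in> B" and es: "is_smallest r e (fund_cocircuit M B e)"
          using I by auto
        \<comment> \<open>Both memberships say that \<open>insert v (B - {e})\<close> is a
          basis.\<close>
        have "v \<in> fund_cocircuit M B e"
          using e eB vB mem_fund_circuit_iff[OF B vB] mem_fund_cocircuit_iff[OF B eB] by auto
        then have "(e, v) \<in> r" "(v, e) \<in> r"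
          using e es vs by (auto simp: is_smallest_def)
        then show False using r eB vB by (auto dest: antisymD)
      qed
      then show "e \<in> insert v (B - I)" using e mem_fund_circuit_iff[OF B vB] by auto
    qed
    then have "fund_circuit M B v \<in> indeps M" using ind indep_subset by blast
    then show False using fund_circuit_eq(2)[OF B vB] by (simp add: is_circuit_def)
  qed
  then show ?thesis using B I J by (auto simp: config_def)
qed

lemma active_config_exists:
  assumes r: "linear_order_on (ground M) r"
    and cfg: "config M B\<^sub>0 I\<^sub>0 J\<^sub>0"
  obtains B I J where "config M B I J" "card I = card I\<^sub>0" "card J = card J\<^sub>0"
    "I \<subseteq> {v \<in> B. is_smallest r v (fund_cocircuit M B v)}"
    "J \<subseteq> {v \<in> ground M - B. is_smallest r v (fund_circuit M B v)}"
proof -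
  \<comment> \<open>The position of \<open>e\<close> counted from the bottom of the order. It turns
    "as early as possible" into minimising a natural number, whose least value is attained.\<close>
  define rank where "rank e = card {u \<in> ground M. (u, e) \<in> r}" for e
  have refl: "(u, u) \<in> r" if "u \<in> ground M" for u
    using r that by (auto simp: order_on_defs refl_on_def)
  have trans: "trans r" and antisym: "antisym r" and total: "total_on (ground M) r"
    using r by (auto simp: order_on_defs)
  have rank_less: "rank d < rank e"
    if "d \<in> ground M" "e \<in> ground M" "(e, d) \<notin> r" for d e
  proof -
    have "(d, e) \<in> r" using that total refl unfolding total_on_def by metis
    \<comment> \<open>The inclusion is strict because \<open>e\<close> belongs only to the
      right-hand set.\<close>
    then have "{u \<in> ground M. (u, d) \<in> r} \<subset> {u \<in> ground M. (u, e) \<in> r}"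
      using that refl[of e] trans by (auto dest: transD)
    then show ?thesis unfolding rank_def using finite_ground by (intro psubset_card_mono) auto
  qed
  define P where "P = (\<lambda>(B, I, J). config M B I J \<and> card I = card I\<^sub>0 \<and> card J = card J\<^sub>0)"
  define m where "m = (\<lambda>(B :: 'a set, I, J). sum rank I + sum rank J)"
  have "P (B\<^sub>0, I\<^sub>0, J\<^sub>0)" using cfg by (simp add: P_def)
  then obtain t where "P t" "\<And>t'. P t' \<Longrightarrow> m t \<le> m t'"
    using ex_has_least_nat[of P _ m] by blast
  then obtain B I J where cfg: "config M B I J" and cards: "card I = card I\<^sub>0" "card J = card J\<^sub>0"
    and min: "\<And>B' I' J'. config M B' I' J' \<Longrightarrow> card I' = card I\<^sub>0 \<Longrightarrow> card J' = card J\<^sub>0 \<Longrightarrow>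
      sum rank I + sum rank J \<le> sum rank I' + sum rank J'"
    by (cases t) (fastforce simp: P_def m_def)
  have B: "is_basis M B" and I: "I \<subseteq> B" and J: "J \<subseteq> ground M - B"
    using cfg by (auto simp: config_def)
  note BE = basis_subset_ground[OF B]
  have fin: "finite I" "finite J"
    using I J B finite_basis finite_ground by (auto intro: finite_subset)
  \<comment> \<open>The additive form avoids truncated subtraction on \<open>nat\<close>.\<close>
  have replace: "card (insert y (S - {x})) = card S"
    "sum rank (insert y (S - {x})) + rank x = sum rank S + rank y"
    if "finite S" "x \<in> S" "y \<notin> S" for S x y
    using that card_Suc_Diff1[of S x] sum.remove[of S x rank] by simp_all
  have "is_smallest r e (fund_cocircuit M B e)" if e: "e \<in> I" for e
    unfolding is_smallest_def
  proof (intro conjI ballI)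
    have eB: "e \<in> B" using e I by blast
    note iff = mem_fund_cocircuit_iff[OF B eB]
    show "e \<in> fund_cocircuit M B e" by (simp add: iff)
    fix d assume d: "d \<in> fund_cocircuit M B e"
    show "(e, d) \<in> r"
    proof (rule ccontr)
      assume nr: "(e, d) \<notin> r"
      then have "d \<noteq> e" using refl eB BE by blast
      then have dB: "d \<in> ground M - B" "is_basis M (insert d (B - {e}))" using d iff by auto
      then have "d \<notin> I" using I by blast
      \<comment> \<open>\<open>J\<close> is kept, so minimality would force
        \<open>rank e \<le> rank d\<close>.\<close>
      have "sum rank I + sum rank J \<le> sum rank (insert d (I - {e})) + sum rank J"
        using min[OF config_exchange_inner(1)[OF cfg e dB]] cards
          replace(1)[OF fin(1) e \<open>d \<notin> I\<close>] by simp
      moreover have "rank d < rank e" using rank_less nr dB eB BE by blast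
      ultimately show False using replace(2)[OF fin(1) e \<open>d \<notin> I\<close>] by linarith
    qed
  qed
  moreover have "is_smallest r v (fund_circuit M B v)" if v: "v \<in> J" for v
    unfolding is_smallest_def
  proof (intro conjI ballI)
    have vB: "v \<in> ground M - B" using v J by blast
    note iff = mem_fund_circuit_iff[OF B vB]
    show "v \<in> fund_circuit M B v" by (simp add: iff)
    fix c assume c: "c \<in> fund_circuit M B v"
    show "(v, c) \<in> r"
    proof (rule ccontr)
      assume nr: "(v, c) \<notin> r"
      then have "c \<noteq> v" using refl vB by blast
      then have cB: "c \<in> B" "is_basis M (insert v (B - {c}))" using c iff by auto
      then have "c \<notin> J" using J by blast
      have "sum rank I + sum rank J \<le> sum rank I + sum rank (insert c (J - {v}))"
        using min[OF config_exchange_outer(1)[OF cfg v cB]] cards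
          replace(1)[OF fin(2) v \<open>c \<notin> J\<close>] by simp
      moreover have "rank c < rank v" using rank_less nr cB vB BE by blast
      ultimately show False using replace(2)[OF fin(2) v \<open>c \<notin> J\<close>] by linarith
    qed
  qed
  ultimately show thesis using that[OF cfg cards] I J by blast
qed

text \<open>The sets of a configuration may be proper subsets of the active elements, hence lower
  bounds on the activities. Conversely, subsets of exactly \<open>k\<close> and \<open>l\<close>
  active elements are selected.\<close>

lemma config_iff_active_basis:
  assumes r: "linear_order_on (ground M) r"
  shows "(\<exists>B I J. config M B I J \<and> card I = k \<and> card J = l) \<longleftrightarrow>
    (\<exists>B. is_basis M B \<and> int_activity M r B \<ge> k \<and> ext_activity M r B \<ge> l)"
proof
  assume "\<exists>B I J. config M B I J \<and> card I = k \<and> card J = l"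
  then obtain B\<^sub>0 I\<^sub>0 J\<^sub>0 where cfg: "config M B\<^sub>0 I\<^sub>0 J\<^sub>0" "card I\<^sub>0 = k" "card J\<^sub>0 = l"
    by blast
  obtain B I J where BIJ: "config M B I J" "card I = k" "card J = l"
    "I \<subseteq> {v \<in> B. is_smallest r v (fund_cocircuit M B v)}"
    "J \<subseteq> {v \<in> ground M - B. is_smallest r v (fund_circuit M B v)}"
    by (rule active_config_exists[OF r cfg(1), unfolded cfg(2,3)])
  then have "is_basis M B" by (simp add: config_def)
  moreover from this have "card I \<le> int_activity M r B" "card J \<le> ext_activity M r B"
    unfolding int_activity_def ext_activity_def
    using BIJ finite_basis finite_ground by (auto intro!: card_mono)
  ultimately show "\<exists>B. is_basis M B \<and> int_activity M r B \<ge> k \<and> ext_activity M r B \<ge> l"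
    using BIJ by blast
next
  assume "\<exists>B. is_basis M B \<and> int_activity M r B \<ge> k \<and> ext_activity M r B \<ge> l"
  then obtain B where B: "is_basis M B" and act: "int_activity M r B \<ge> k" "ext_activity M r B \<ge> l"
    by blast
  obtain I where "I \<subseteq> {v \<in> B. is_smallest r v (fund_cocircuit M B v)}" "card I = k"
    using act(1) obtain_subset_with_card_n unfolding int_activity_def by metis
  moreover obtain J where "J \<subseteq> {v \<in> ground M - B. is_smallest r v (fund_circuit M B v)}" "card J = l"
    using act(2) obtain_subset_with_card_n unfolding ext_activity_def by metis
  moreover have "antisym r" using r by (simp add: order_on_defs)
  ultimately show "\<exists>B I J. config M B I J \<and> card I = k \<and> card J = l"
    using config_active[OF _ B] by blast
qed

section \<open>Coefficients of the Tutte polynomial\<close>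

lemma finite_bases: "finite {B. is_basis M B}"
  by (rule finite_subset[of _ "Pow (ground M)"]) (use basis_subset_ground finite_ground in auto)

text \<open>Each basis contributes one monomial with coefficient 1, so nothing cancels and vanishing
  means that no such basis exists.\<close>

lemma tutte_coeff_eq_card:
  "tutte_coeff M r i j =
    int (card {B. is_basis M B \<and> int_activity M r B = i \<and> ext_activity M r B = j})"
proof -
  have "tutte_coeff M r i j =
      (\<Sum>B | is_basis M B. if int_activity M r B = i \<and> ext_activity M r B = j then 1 else 0)"
    unfolding tutte_coeff_def tutte_poly_def coeff_sum by (intro sum.cong) auto
  also have "\<dots> = int (card ({B. is_basis M B} \<inter>
      {B. int_activity M r B = i \<and> ext_activity M r B = j}))"
    using finite_bases by (simp add: sum.If_cases)
  finally show ?thesis by (simp add: Int_def)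
qed

lemma tutte_coeff_eq_0_iff:
  "tutte_coeff M r i j = 0 \<longleftrightarrow>
    \<not> (\<exists>B. is_basis M B \<and> int_activity M r B = i \<and> ext_activity M r B = j)"
proof -
  have "finite {B. is_basis M B \<and> int_activity M r B = i \<and> ext_activity M r B = j}"
    using finite_bases by (rule finite_subset[rotated]) auto
  then show ?thesis by (auto simp: tutte_coeff_eq_card)
qed

end

theorem theorem1p1:
  fixes M :: "'a indep_system" and r :: "'a rel" and k l :: nat
  assumes "k > 0" and "l > 0"
    and "matroid M"
    and "linear_order_on (ground M) r"
  shows "kl_uniform k l M \<longleftrightarrow> (\<forall>i j. i \<ge> k \<and> j \<ge> l \<longrightarrow> tutte_coeff M r i j = 0)"
proof -
  interpret matroid M by fact
  \<comment> \<open>A basis with activities at least \<open>k\<close> and \<open>l\<close> gives a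
    nonzero coefficient, with \<open>i\<close> and \<open>j\<close> taken to be its activities, and
    conversely.\<close>
  show ?thesis
    using config_iff_minor[of k l] config_iff_active_basis[OF assms(4), of k l]
    by (auto simp: tutte_coeff_eq_0_iff)
qed

end
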